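(* Let $z_1=e^{\imath\xi_1}$ and $z_2=e^{\imath\xi_2}$ with $\xi_1,\xi_2\in\mathbb{R}$, $\xi_2=\xi_1+\delta$ and $0<\delta<1$. Fix some $0<r_0<2\pi$. Then for any integer $p\ge1$ satisfying $p\delta<r_0$ we have $$|z_1^p-z_2^p|>\alpha(r_0)\,p\,\delta,\qquad\text{where}\quad \alpha(r)=\frac{\sqrt{2(1-\cos r)}}{r}.$$ *)

theory Defs
  imports Complex_Main
begin

definition alpha :: "real \<Rightarrow> real" where
  "alpha r = sqrt (2 * (1 - cos r)) / r"

end

theory Submission
  imports Defs "HOL-Analysis.Complex_Transcendental"
begin

text \<open>
  The chord between \<open>exp (\<i> * p * \<xi>1)\<close> and \<open>exp (\<i> * p * \<xi>2)\<close> has length \<open>2 * sin (p * \<delta> / 2)\<close>,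
  and \<open>alpha r = 2 * sin (r / 2) / r\<close> on \<open>(0, 2 * pi)\<close>, so the claim says that
  \<open>sin t / t\<close> is strictly decreasing on \<open>(0, pi)\<close>.
\<close>

text \<open>By the mean value theorem the slopes of the chords of \<open>sin\<close> over \<open>[0, x]\<close> and \<open>[x, y]\<close>
  are \<open>cos c\<close> and \<open>cos d\<close> with \<open>c < d\<close>.\<close>

lemma sin_over_self_strict_decreasing:
  fixes x y :: real
  assumes "0 < x" and "x < y" and "y \<le> pi"
  shows "sin y / y < sin x / x"
proof -
  obtain c where c: "0 < c" "c < x" "sin x - sin 0 = (x - 0) * cos c"
    using MVT2[of 0 x sin cos] assms(1) by (metis DERIV_sin)
  obtain d where d: "x < d" "d < y" "sin y - sin x = (y - x) * cos d"
    using MVT2[of x y sin cos] assms(2) by (metis DERIV_sin)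
  have "cos d < cos c"
    using c d assms by (intro cos_monotone_0_pi) auto
  then have "(y - x) * cos d < (y - x) * cos c"
    using assms(2) by simp
  \<comment> \<open>Adding the two chords gives \<open>sin y = x * cos c + (y - x) * cos d\<close>,
    and \<open>cos c\<close> is \<open>sin x / x\<close>.\<close>
  then have "sin y < y * cos c"
    using c(3) d(3) by (simp add: algebra_simps)
  then show ?thesis
    using assms c(3) by (simp add: field_simps)
qed

text \<open>Factoring out the unit \<open>exp (\<i> * s)\<close> rotates one endpoint to 1.\<close>

lemma norm_exp_i_diff:
  fixes s t :: real
  shows "norm (exp (\<i> * complex_of_real s) - exp (\<i> * complex_of_real t)) = 2 * \<bar>sin ((t - s) / 2)\<bar>"
proof -
  have "exp (\<i> * complex_of_real s) - exp (\<i> * complex_of_real t)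
      = exp (\<i> * complex_of_real s) * (1 - exp (\<i> * complex_of_real (t - s)))"
    by (simp add: algebra_simps flip: exp_add)
  then show ?thesis
    using dist_exp_i_1[of "t - s"] by (simp add: norm_mult norm_minus_commute)
qed

text \<open>Half-angle formula; the range of \<open>r\<close> keeps \<open>sin (r / 2)\<close>
  nonnegative, so the root needs no absolute value.\<close>

lemma alpha_eq_sin:
  assumes "0 \<le> r" and "r \<le> 2 * pi"
  shows "alpha r = sin (r / 2) / (r / 2)"
proof -
  have "2 * (1 - cos r) = (2 * sin (r / 2))\<^sup>2"
    using cos_double_sin[of "r / 2"] by (simp add: power_mult_distrib)
  moreover have "0 \<le> sin (r / 2)"
    using assms by (intro sin_ge_zero) auto
  ultimately have "sqrt (2 * (1 - cos r)) = 2 * sin (r / 2)"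
    by (simp only: real_sqrt_abs)
  then show ?thesis
    by (simp add: alpha_def)
qed

theorem lemma2p16:
  fixes \<xi>1 \<xi>2 \<delta> r0 :: real and z1 z2 :: complex and p :: nat
  assumes "z1 = exp (\<i> * complex_of_real \<xi>1)"
    and "z2 = exp (\<i> * complex_of_real \<xi>2)"
    and "\<xi>2 = \<xi>1 + \<delta>"
    and "0 < \<delta>" and "\<delta> < 1"
    and "0 < r0" and "r0 < 2 * pi"
    and "1 \<le> p"
    and "real p * \<delta> < r0"
  shows "norm (z1 ^ p - z2 ^ p) > alpha r0 * real p * \<delta>"
proof -
  let ?t = "real p * \<delta>"
  have t: "0 < ?t"
    using assms by simp
  have "sin (r0 / 2) / (r0 / 2) < sin (?t / 2) / (?t / 2)"
    using t assms by (intro sin_over_self_strict_decreasing) auto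
  then have "alpha r0 < sin (?t / 2) / (?t / 2)"
    using alpha_eq_sin[of r0] assms by simp
  then have "alpha r0 * ?t < 2 * sin (?t / 2)"
    using t by (simp add: field_simps)
  also have "\<dots> \<le> 2 * \<bar>sin (?t / 2)\<bar>"
    by simp
  \<comment> \<open>De Moivre: the powers have angles \<open>p * \<xi>1\<close> and
    \<open>p * \<xi>2\<close>, which differ by \<open>p * \<delta>\<close>.\<close>
  also have "\<dots> = norm (z1 ^ p - z2 ^ p)"
    using norm_exp_i_diff[of "real p * \<xi>1" "real p * \<xi>2"] assms(1-3)
    by (simp add: algebra_simps flip: exp_of_nat_mult)
  finally show ?thesis
    by (simp add: mult.assoc)
qed

end
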